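(* Let ${\bf n}$ be the fixed point starting with $0$ of the morphism $0\mapsto01$, $1\mapsto2$, $2\mapsto0$. For every $i\ge0$, the number of distinct factors of length $i$ of ${\bf n}$ is $2i+1$. *)

theory Defs
  imports "HOL-Library.Omega_Words_Fun"
begin

definition morph :: "('a \<Rightarrow> 'b list) \<Rightarrow> 'a list \<Rightarrow> 'b list" where
  "morph h u = concat (map h u)"

text \<open>
  The extension of a morphism to infinite words. For nonerasing \<open>h\<close> (no letter is mapped to the
  empty word) the image of the prefix of length \<open>k + 1\<close> has at least \<open>k + 1\<close> letters, so its
  letter number \<open>k\<close> is the letter number \<open>k\<close> of \<open>h(w)\<close>. The definition is meaningful only for
  such \<open>h\<close>.
\<close>

definition morph_omega :: "('a \<Rightarrow> 'b list) \<Rightarrow> 'a word \<Rightarrow> 'b word" where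
  "morph_omega h w = (\<lambda>k. morph h (prefix (Suc k) w) ! k)"

definition factors_of_length :: "'a word \<Rightarrow> nat \<Rightarrow> 'a list set" where
  "factors_of_length w i = {w [j \<rightarrow> j + i] | j. True}"

datatype letter = L0 | L1 | L2

fun narayana :: "letter \<Rightarrow> letter list" where
  "narayana L0 = [L0, L1]"
| "narayana L1 = [L2]"
| "narayana L2 = [L0]"

text \<open>Existence and uniqueness of the fixed point that starts with \<open>L0\<close>.\<close>

lemma length_morph_narayana: "length u \<le> length (morph narayana u)"
proof (induction u)
  case (Cons a u)
  then show ?case by (cases a) (simp_all add: morph_def)
qed (simp add: morph_def)

lemma length_morph_narayana_strict:
  "u \<noteq> [] \<Longrightarrow> hd u = L0 \<Longrightarrow> length u < length (morph narayana u)"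
proof (cases u)
  case (Cons a v)
  assume "hd u = L0"
  then show ?thesis using Cons length_morph_narayana[of v] by (simp add: morph_def)
qed simp

lemma morph_omega_narayana_Suc:
  assumes "w 0 = L0"
  shows "morph_omega narayana w (Suc k) = morph narayana (prefix (Suc k) w) ! Suc k"
proof -
  have hd: "hd (prefix (Suc k) w) = L0"
    using assms by (simp add: subsequence_def hd_map del: upt_Suc)
  have "Suc k < length (morph narayana (prefix (Suc k) w))"
    using length_morph_narayana_strict[OF _ hd] by simp
  moreover have "morph narayana (prefix (Suc (Suc k)) w)
      = morph narayana (prefix (Suc k) w) @ narayana (w (Suc k))"
    by (simp add: morph_def subsequence_def)
  ultimately show ?thesis
    by (simp add: morph_omega_def nth_append)
qed

lemma morph_omega_narayana_0: "w 0 = L0 \<Longrightarrow> morph_omega narayana w 0 = L0"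
  by (simp add: morph_omega_def morph_def)

primrec narayana_prefix :: "nat \<Rightarrow> letter list" where
  "narayana_prefix 0 = [L0]"
| "narayana_prefix (Suc k) = narayana_prefix k @ [morph narayana (narayana_prefix k) ! Suc k]"

theorem narayana_fixed_point_ex1:
  "\<exists>!w. morph_omega narayana w = w \<and> w 0 = L0"
proof (rule ex_ex1I)
  define w where "w = (\<lambda>k. last (narayana_prefix k))"
  have pre: "prefix (Suc k) w = narayana_prefix k" for k
    by (induction k) (simp_all add: w_def subsequence_def)
  have w0: "w 0 = L0" by (simp add: w_def)
  have "morph_omega narayana w k = w k" for k
  proof (cases k)
    case 0
    then show ?thesis using w0 morph_omega_narayana_0[of w] by simp
  next
    case (Suc m)
    then show ?thesis
      using morph_omega_narayana_Suc[of w m] w0 pre[of m] by (simp add: w_def)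
  qed
  then show "\<exists>w. morph_omega narayana w = w \<and> w 0 = L0" using w0 by blast
next
  fix v w
  assume v: "morph_omega narayana v = v \<and> v 0 = L0"
    and w: "morph_omega narayana w = w \<and> w 0 = L0"
  have "prefix (Suc k) v = prefix (Suc k) w" for k
  proof (induction k)
    case 0
    then show ?case using v w by simp
  next
    case (Suc k)
    have "v (Suc k) = w (Suc k)"
      using v w morph_omega_narayana_Suc[of v k] morph_omega_narayana_Suc[of w k] Suc by simp
    then show ?case using Suc by (simp add: subsequence_def)
  qed
  then have "v k = w k" for k
    by (metis diff_zero lessI plus_nat.add_0 subsequence_nth)
  then show "v = w" by blast
qed

end

theory Submission
  imports Defs
begin

text \<open>
  Every prefix of \<open>n\<close> can be preceded in \<open>n\<close> by each of the three letters: applying the morphism to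
  an occurrence of \<open>a u\<close> gives an occurrence of \<open>h(u)\<close> preceded by the last letter of \<open>h(a)\<close>, and
  these last letters are distinct. Conversely, desubstitution shows by induction on the length that
  a factor preceded by two different letters is a prefix of \<open>n\<close>. Hence deleting the first letter
  maps the factors of length \<open>i + 1\<close> onto those of length \<open>i\<close>, with a fibre of size 3 over the
  prefix and fibres of size 1 elsewhere, so each step adds exactly 2 factors.
\<close>

section \<open>Images of words, and factors as shifted maps\<close>

lemma morph_append: "morph h (u @ v) = morph h u @ morph h v"
  by (simp add: morph_def)

lemma last_narayana_surj: "\<exists>a. last (narayana a) = b"
proof (cases b)
  case L0
  then show ?thesis by (intro exI[of _ L2]) simp
next
  case L1
  then show ?thesis by (intro exI[of _ L0]) simp
next
  case L2
  then show ?thesis by (intro exI[of _ L1]) simp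
qed

lemma UNIV_letter: "(UNIV :: letter set) = {L0, L1, L2}"
  using letter.exhaust by blast

lemma mem_factors_of_length_iff:
  "u \<in> factors_of_length w i \<longleftrightarrow> (\<exists>j. u = map (\<lambda>t. w (j + t)) [0..<i])"
proof -
  have "w [j \<rightarrow> j + i] = map (\<lambda>t. w (j + t)) [0..<i]" for j
    by (rule nth_equalityI) simp_all
  then show ?thesis by (auto simp: factors_of_length_def)
qed

lemma map_upt_0_Suc: "map f [0..<Suc i] = f 0 # map (\<lambda>t. f (Suc t)) [0..<i]"
  by (rule nth_equalityI) (auto simp: nth_Cons' simp del: upt_Suc)

section \<open>Cutting the fixed point into the images of its letters\<close>

locale narayana_word =
  fixes n :: "letter word"
  assumes fixed: "morph_omega narayana n = n" and start: "n 0 = L0"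
begin

text \<open>This is the position in \<open>n\<close> at which the image of the letter
  \<open>n k\<close> begins, so the blocks \<open>narayana (n k)\<close> follow one another in
  \<open>n\<close>.\<close>

definition block :: "nat \<Rightarrow> nat" where
  "block k = length (morph narayana (prefix k n))"

text \<open>The images of prefixes of \<open>n\<close> are prefixes of one another, and the
  fixed-point equation reads letter \<open>m\<close> off the image of the prefix of length
  \<open>Suc m\<close>.\<close>

lemma nth_morph_prefix:
  assumes "m < block k"
  shows "morph narayana (prefix k n) ! m = n m"
proof -
  have ext: "morph narayana (prefix (j + d) n) ! m = morph narayana (prefix j n) ! m"
    if "m < block j" for j d
  proof -
    have "prefix (j + d) n = prefix j n @ n [j \<rightarrow> j + d]"
      by (rule nth_equalityI) (auto simp: nth_append)
    then show ?thesis using that by (simp add: morph_append nth_append block_def)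
  qed
  have "m < block (Suc m)"
    using length_morph_narayana[of "prefix (Suc m) n"] by (simp add: block_def)
  \<comment> \<open>Both sides are compared with the image of the prefix of length
    \<open>k + Suc m\<close>.\<close>
  then have "morph narayana (prefix k n) ! m = morph narayana (prefix (Suc m) n) ! m"
    using ext[of k "Suc m"] ext[of "Suc m" k] assms by (simp add: add.commute)
  also have "\<dots> = n m"
    using fun_cong[OF fixed, of m] by (simp add: morph_omega_def)
  finally show ?thesis .
qed

lemma morph_prefix_Suc:
  "morph narayana (prefix (Suc k) n) = morph narayana (prefix k n) @ narayana (n k)"
  by (simp add: morph_def subsequence_def)

lemma block_0 [simp]: "block 0 = 0"
  by (simp add: block_def morph_def)

lemma block_Suc_length: "block (Suc k) = block k + length (narayana (n k))"
  unfolding block_def morph_prefix_Suc by simp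

lemma nth_block: "i < length (narayana (n k)) \<Longrightarrow> n (block k + i) = narayana (n k) ! i"
  using nth_morph_prefix[of "block k + i" "Suc k", unfolded morph_prefix_Suc]
  by (simp add: block_Suc_length nth_append) (simp add: block_def)

lemma block_Suc: "block (Suc k) = (if n k = L0 then block k + 2 else block k + 1)"
  by (cases "n k") (simp_all add: block_Suc_length)

lemma at_block: "n (block k) = (if n k = L1 then L2 else L0)"
  using nth_block[of 0 k] by (cases "n k") simp_all

lemma at_Suc_block: "n k = L0 \<Longrightarrow> n (Suc (block k)) = L1"
  using nth_block[of 1 k] by simp

lemma before_block_Suc:
  obtains j where "block (Suc k) = Suc j" "n j = last (narayana (n k))"
  using nth_block[of "length (narayana (n k)) - 1" k]
  by (cases "n k") (simp_all add: block_Suc)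

text \<open>Images have at most two letters, and only that of \<open>L0\<close> has a second one.
  This is the case split for every desubstitution below.\<close>

lemma block_cases:
  obtains k where "m = block k" | k where "m = Suc (block k)" "n k = L0"
proof -
  have "\<exists>k. m = block k \<or> m = Suc (block k) \<and> n k = L0"
  proof (induction m)
    case 0
    show ?case by (rule exI[of _ 0]) simp
  next
    case (Suc m)
    then obtain k where k: "m = block k \<or> m = Suc (block k) \<and> n k = L0" by blast
    show ?case
    proof (cases "m = block k \<and> n k = L0")
      case False
      then show ?thesis using k block_Suc[of k] by (intro exI[of _ "Suc k"]) auto
    qed blast
  qed
  then show thesis using that by blast
qed

text \<open>The leading \<open>L0\<close> has an image of length 2 and every other image has at
  least one letter. This strict growth drives both inductions on word length.\<close>

lemma Suc_le_block: "0 < s \<Longrightarrow> Suc s \<le> block s"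
proof (induction s rule: nat_induct_non_zero)
  case 1
  then show ?case using block_Suc[of 0] start by simp
next
  case (Suc s)
  then show ?case using block_Suc[of s] by auto
qed

section \<open>Letters forced to the left of a given context\<close>

lemma before_L1:
  assumes "n (Suc j) = L1"
  shows "n j = L0"
proof (cases rule: block_cases[of "Suc j"])
  case (1 k)
  then show ?thesis using assms at_block[of k] by (auto split: if_splits)
next
  case (2 k)
  then show ?thesis using at_block[of k] by simp
qed

lemma block_pos:
  assumes "Suc j = block k"
  obtains k' where "k = Suc k'" "n j = last (narayana (n k'))"
proof (cases k)
  case (Suc k')
  then show ?thesis using that assms before_block_Suc[of k'] by (metis nat.inject)
qed (use assms in simp)

text \<open>\<open>L2\<close> arises only as the image of \<open>L1\<close>, whose predecessor
  \<open>L0\<close> has an image ending in \<open>L1\<close>.\<close>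

lemma before_L2:
  assumes "n (Suc j) = L2"
  shows "n j = L1"
proof (cases rule: block_cases[of "Suc j"])
  case (1 k)
  then have "n k = L1" using assms at_block[of k] by (auto split: if_splits)
  with 1 show ?thesis using before_L1 by (elim block_pos) auto
next
  case (2 k)
  then show ?thesis using assms at_Suc_block[of k] by simp
qed

text \<open>An \<open>L0\<close> followed by another \<open>L0\<close> is the image of
  \<open>L2\<close>; the predecessor \<open>L1\<close> of that \<open>L2\<close> has the image
  \<open>L2\<close>.\<close>

lemma before_L0_L0:
  assumes "n (Suc j) = L0" "n (Suc (Suc j)) = L0"
  shows "n j = L2"
proof (cases rule: block_cases[of "Suc j"])
  case (1 k)
  then have "n k = L2"
    using assms at_block[of k] at_Suc_block[of k] by (cases "n k") simp_all
  with 1 show ?thesis using before_L2 by (elim block_pos) auto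
next
  case (2 k)
  then show ?thesis using assms at_Suc_block[of k] by simp
qed

text \<open>Were this \<open>L0\<close> the image of \<open>L2\<close>, the following
  \<open>L1\<close> would begin a block, which never happens. So the pair is the image of an
  \<open>L0\<close>.\<close>

lemma before_L0_L1:
  assumes "n (Suc j) = L0" "n (Suc (Suc j)) = L1"
  obtains k where "Suc j = block (Suc k)" "n (Suc k) = L0" "n j = last (narayana (n k))"
proof (cases rule: block_cases[of "Suc j"])
  case (1 k)
  then have "n k = L0"
    using assms at_block[of k] block_Suc[of k] at_block[of "Suc k"]
    by (cases "n k") (auto split: if_splits)
  with 1 show ?thesis using that by (metis block_pos)
next
  case (2 k)
  then show ?thesis using assms at_Suc_block[of k] by simp
qed

section \<open>Occurrences of prefixes and left special factors\<close>

text \<open>Equal letters have equal images, so the morphism carries an occurrence of a prefix at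
  \<open>a\<close> to an occurrence of a longer or equal prefix at \<open>block a\<close>.\<close>

lemma block_shift:
  assumes "\<And>i. i < s \<Longrightarrow> n (a + i) = n i"
  shows "block (a + s) = block a + block s"
    and "t < block s \<Longrightarrow> n (block a + t) = n t"
proof -
  have "block (a + s) = block a + block s \<and> (\<forall>t < block s. n (block a + t) = n t)"
    using assms
  proof (induction s)
    case (Suc s)
    have IH: "block (a + s) = block a + block s" "\<forall>t < block s. n (block a + t) = n t"
      using Suc.IH[OF Suc.prems[OF less_SucI]] by metis+
    have eq: "n (a + s) = n s" using Suc.prems[OF lessI] .
    have "n (block a + t) = n t" if "t < block (Suc s)" for t
    proof (cases "t < block s")
      case False
      define i where "i = t - block s"
      have t: "t = block s + i" and i: "i < length (narayana (n s))"
        using False that unfolding i_def block_Suc_length by simp_all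
      have "n (block (a + s) + i) = narayana (n s) ! i"
        using nth_block[of i "a + s"] i unfolding eq by blast
      then show ?thesis
        using nth_block[OF i] unfolding t IH(1) add.assoc by metis
    qed (use IH in blast)
    moreover have "block (a + Suc s) = block a + block (Suc s)"
      using IH(1) eq by (simp add: block_Suc)
    ultimately show ?case by blast
  qed simp
  then show "block (a + s) = block a + block s" "t < block s \<Longrightarrow> n (block a + t) = n t"
    by blast+
qed

text \<open>Distinct left neighbours force the common word to be \<open>L0\<close> or to begin with
  \<open>L0\<close>, \<open>L1\<close>. In the second case it starts at block boundaries, and the
  preimages, again with distinct left neighbours, are compared with \<open>n\<close> up to the first
  index \<open>s\<close> where one of them departs from it.\<close>

lemma left_special_prefix:
  assumes "n j \<noteq> n j'" and "\<And>t. t < l \<Longrightarrow> n (Suc j + t) = n (Suc j' + t)" and "t < l"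
  shows "n (Suc j + t) = n t"
  using assms
proof (induction l arbitrary: j j' t rule: less_induct)
  case (less l)
  note agree = less.prems(2)
  have "n (Suc j) = n (Suc j')" using agree[of 0] \<open>t < l\<close> by simp
  then have first: "n (Suc j) = L0" "n (Suc j') = L0"
    using less.prems(1) before_L1 before_L2 by (cases "n (Suc j)"; metis)+
  show ?case
  proof (cases "l = 1")
    case True
    then show ?thesis using first start \<open>t < l\<close> by simp
  next
    case False
    then have "n (Suc (Suc j)) = n (Suc (Suc j'))" using agree[of 1] \<open>t < l\<close> by simp
    then have second: "n (Suc (Suc j)) = L1" "n (Suc (Suc j')) = L1"
      using less.prems(1) before_L0_L0 before_L2[of "Suc j"] first
      by (cases "n (Suc (Suc j))"; metis letter.distinct)+
    obtain k where k: "Suc j = block (Suc k)" "n (Suc k) = L0" "n j = last (narayana (n k))"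
      using before_L0_L1[OF first(1) second(1)] .
    obtain k' where k': "Suc j' = block (Suc k')" "n (Suc k') = L0"
      "n j' = last (narayana (n k'))"
      using before_L0_L1[OF first(2) second(2)] .
    have neq: "n k \<noteq> n k'" using less.prems(1) k(3) k'(3) by auto
    define bad where "bad s \<longleftrightarrow> \<not> (n (Suc k + s) = n s \<and> n (Suc k' + s) = n s)" for s
    show ?thesis
    proof (cases "\<exists>s. bad s")
      case False
      then have "n (Suc k + i) = n i" for i by (simp add: bad_def)
      moreover have "t < block (Suc t)" using Suc_le_block[of "Suc t"] by simp
      ultimately show ?thesis using block_shift(2)[of "Suc t" "Suc k" t] k(1) by simp
    next
      case True
      define s where "s = (LEAST s. bad s)"
      have "bad s" using True unfolding s_def by (rule LeastI_ex)
      have good: "\<not> bad i" if "i < s" for i using that not_less_Least unfolding s_def by blast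
      have agree_k: "n (Suc k + i) = n i" "n (Suc k' + i) = n i" if "i < s" for i
        using good[OF that] by (simp_all add: bad_def)
      have "s \<noteq> 0" using \<open>bad s\<close> k(2) k'(2) start by (metis add_0_right bad_def)
      then obtain r where r: "s = Suc r" using not0_implies_Suc by blast
      have blk: "block (Suc k + s) = Suc j + block s" "block (Suc k' + s) = Suc j' + block s"
        using block_shift(1)[of s "Suc k"] block_shift(1)[of s "Suc k'"] agree_k k(1) k'(1) by simp_all
      have below: "n (Suc j + t) = n t" if "t < block s" for t
        using block_shift(2)[of s "Suc k" t] agree_k(1) k(1) that by simp
      show ?thesis
      proof (cases "t < block s")
        case False
        then have "block s < l" using \<open>t < l\<close> by simp
        have "Suc s < l" using Suc_le_block[of s] \<open>s \<noteq> 0\<close> \<open>block s < l\<close> by simp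
        \<comment> \<open>Agreement at \<open>s\<close> would give a common word of length
          \<open>Suc s < l\<close> with distinct left neighbours \<open>n k\<close> and
          \<open>n k'\<close>; by induction both would match \<open>n\<close> at \<open>s\<close>,
          against the choice of \<open>s\<close>.\<close>
        have differ: "n (Suc k + s) \<noteq> n (Suc k' + s)"
        proof
          assume eq: "n (Suc k + s) = n (Suc k' + s)"
          have "n (Suc k + i) = n (Suc k' + i)" if "i < Suc s" for i
            using that eq agree_k by (cases "i = s") simp_all
          then have "n (Suc k + s) = n s"
            using less.IH[OF \<open>Suc s < l\<close> neq, of s] by blast
          then show False using eq \<open>bad s\<close> by (simp add: bad_def)
        qed
        \<comment> \<open>Position \<open>block s\<close> still lies in the common word. Only the
          image of \<open>L1\<close> begins with \<open>L2\<close>, so the two differing letters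
          must be \<open>L0\<close> and \<open>L2\<close> in some order.\<close>
        have heads: "n (block (Suc k + s)) = n (block (Suc k' + s))"
          using agree[OF \<open>block s < l\<close>] blk by simp
        have ne1: "n (Suc k + s) \<noteq> L1" "n (Suc k' + s) \<noteq> L1"
          using heads differ at_block[of "Suc k + s"] at_block[of "Suc k' + s"]
          by (auto split: if_splits)
        then have "n (Suc k + s) = L2 \<or> n (Suc k' + s) = L2"
          using differ by (cases "n (Suc k + s)"; cases "n (Suc k' + s)") simp_all
        \<comment> \<open>The \<open>L2\<close> among them is preceded by \<open>L1\<close>, at an
          index where the preimages still agree with \<open>n\<close>. Hence \<open>n s\<close> is
          not \<open>L1\<close>, and its image begins with \<open>L0\<close> like the other
          two.\<close>
        then have "n r = L1"
          using before_L2[of "Suc k + r"] before_L2[of "Suc k' + r"] agree_k[of r] r by auto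
        then have "n s \<noteq> L1" using before_L1[of r] r by auto
        then have at: "n (Suc j + block s) = n (block s)"
          using at_block[of s] at_block[of "Suc k + s"] ne1 blk by simp
        \<comment> \<open>The image of \<open>L0\<close> continues with \<open>L1\<close>, whereas
          after the image of \<open>L2\<close> a new block starts, never with \<open>L1\<close>. So
          \<open>block s\<close> is the last index of the common word.\<close>
        have "l \<le> Suc (block s)"
        proof (rule ccontr)
          assume "\<not> l \<le> Suc (block s)"
          then have "n (Suc (block (Suc k + s))) = n (Suc (block (Suc k' + s)))"
            using agree[of "Suc (block s)"] blk by simp
          moreover have "n (Suc (block m)) = L1 \<longleftrightarrow> n m = L0" if "n m \<noteq> L1" for m
            using that at_Suc_block[of m] block_Suc[of m] at_block[of "Suc m"]
            by (auto split: if_splits)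
          ultimately have "n (Suc k + s) = L0 \<longleftrightarrow> n (Suc k' + s) = L0" using ne1 by metis
          then show False
            using differ ne1 by (cases "n (Suc k + s)"; cases "n (Suc k' + s)") simp_all
        qed
        then have "t = block s" using False \<open>t < l\<close> by simp
        then show ?thesis using at by simp
      qed (rule below)
    qed
  qed
qed

section \<open>Left extensions of prefixes\<close>

lemma initial_letters: "n 1 = L1" "n 2 = L2" "n 3 = L0" "n 4 = L0" "n 5 = L1" "n 6 = L0"
proof -
  have b1: "block 1 = 2" using block_Suc[of 0] start by simp
  show n1: "n 1 = L1" using at_Suc_block[of 0] start by simp
  show n2: "n 2 = L2" using at_block[of 1] b1 n1 by simp
  have b2: "block 2 = 3" using block_Suc[of 1] b1 n1 by (simp add: numeral_2_eq_2)
  show n3: "n 3 = L0" using at_block[of 2] b2 n2 by simp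
  have b3: "block 3 = 4" using block_Suc[of 2] b2 n2 by (simp add: numeral_3_eq_3)
  show n4: "n 4 = L0" using at_block[of 3] b3 n3 by simp
  show "n 5 = L1" using at_Suc_block[of 3] b3 n3 by simp
  have b4: "block 4 = 6" using block_Suc[of 3] b3 n3 by simp
  show "n 6 = L0" using at_block[of 4] b4 n4 by simp
qed

lemma prefix_left_extensions: "\<exists>j. n j = a \<and> (\<forall>t < l. n (Suc j + t) = n t)"
proof (induction l arbitrary: a)
  case 0
  show ?case using start initial_letters by (cases a) auto
next
  case (Suc l)
  show ?case
  proof (cases "l = 0")
    case True
    \<comment> \<open>Length 1 needs explicit occurrences because \<open>block 0 = 0\<close> gives
      no growth: the \<open>L0\<close> at 3, 4 and 6 follow \<open>L2\<close>, \<open>L0\<close> and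
      \<open>L1\<close>.\<close>
    have "n (Suc 2) = L0" "n (Suc 3) = L0" "n (Suc 5) = L0"
      using initial_letters by simp_all
    then have "\<exists>j. n j = a \<and> n (Suc j) = L0"
      using initial_letters by (cases a) blast+
    then show ?thesis using True start by simp
  next
    case False
    obtain c where c: "last (narayana c) = a" using last_narayana_surj by blast
    obtain j where j: "n j = c" "\<And>t. t < l \<Longrightarrow> n (Suc j + t) = n t" using Suc.IH by blast
    obtain m where m: "block (Suc j) = Suc m" "n m = last (narayana (n j))"
      using before_block_Suc .
    have "n (Suc m + t) = n t" if "t < Suc l" for t
      using block_shift(2)[of l "Suc j" t, OF j(2)] Suc_le_block[of l] False that m(1) by simp
    then show ?thesis using m(2) j(1) c by blast
  qed
qed

section \<open>Counting factors by their left extensions\<close>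

lemma card_factors_of_length_Suc:
  "card (factors_of_length n (Suc i)) = card (factors_of_length n i) + 2"
proof -
  let ?F = "factors_of_length n"
  define p where "p = map n [0..<i]"
  define X where "X = {u \<in> ?F (Suc i). tl u \<noteq> p}"
  have fin: "finite (?F k)" for k
  proof (rule finite_subset)
    show "?F k \<subseteq> {u. set u \<subseteq> UNIV \<and> length u = k}"
      by (auto simp: mem_factors_of_length_iff)
    show "finite {u :: letter list. set u \<subseteq> UNIV \<and> length u = k}"
      by (rule finite_lists_length_eq) (simp add: UNIV_letter)
  qed
  have Suc_iff: "u \<in> ?F (Suc i) \<longleftrightarrow> (\<exists>j. u = n j # map (\<lambda>t. n (Suc j + t)) [0..<i])" for u
    by (simp add: mem_factors_of_length_iff map_upt_0_Suc del: upt_Suc)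
  have p: "p \<in> ?F i" by (auto simp: mem_factors_of_length_iff p_def intro!: exI[of _ 0])
  have ext: "a # p \<in> ?F (Suc i)" for a
    using prefix_left_extensions[of a i] unfolding Suc_iff p_def by auto
  have split: "?F (Suc i) = (\<lambda>a. a # p) ` UNIV \<union> X"
    using ext unfolding X_def by (auto simp: Suc_iff)
  have "card (?F (Suc i)) = card ((\<lambda>a. a # p) ` UNIV) + card X"
    unfolding split by (rule card_Un_disjoint) (use fin in \<open>auto simp: X_def UNIV_letter\<close>)
  also have "card ((\<lambda>a. a # p) ` UNIV) = 3"
    by (subst card_image) (simp_all add: inj_on_def UNIV_letter)
  also have "card X = card (tl ` X)"
  proof (rule card_image[symmetric], rule inj_onI)
    fix u v assume "u \<in> X" "v \<in> X" and eq: "tl u = tl v"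
    then obtain j j' where u: "u = n j # map (\<lambda>t. n (Suc j + t)) [0..<i]"
      and v: "v = n j' # map (\<lambda>t. n (Suc j' + t)) [0..<i]" and "tl u \<noteq> p"
      unfolding X_def Suc_iff by blast
    have "n j = n j'"
    proof (rule ccontr)
      assume "n j \<noteq> n j'"
      moreover have "n (Suc j + t) = n (Suc j' + t)" if "t < i" for t
        using eq u v that by simp
      ultimately have "n (Suc j + t) = n t" if "t < i" for t
        using left_special_prefix that by blast
      then show False using \<open>tl u \<noteq> p\<close> u by (simp add: p_def)
    qed
    then show "u = v" using u v eq by simp
  qed
  also have "tl ` X = ?F i - {p}"
  proof (intro equalityI subsetI)
    fix w assume "w \<in> ?F i - {p}"
    then obtain j where w: "w = map (\<lambda>t. n (j + t)) [0..<i]" "w \<noteq> p"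
      by (auto simp: mem_factors_of_length_iff)
    \<comment> \<open>Position 0 would give the prefix \<open>p\<close>, so this occurrence has a
      letter to its left.\<close>
    then obtain m where "j = Suc m" unfolding p_def by (cases j) auto
    then have "n m # w \<in> X" using w by (auto simp: X_def Suc_iff)
    then show "w \<in> tl ` X" by force
  next
    fix w assume "w \<in> tl ` X"
    then obtain u where u: "u \<in> ?F (Suc i)" "w = tl u" "w \<noteq> p"
      unfolding X_def by blast
    then obtain j where "u = n j # map (\<lambda>t. n (Suc j + t)) [0..<i]"
      unfolding Suc_iff by blast
    with u(2) have "w = map (\<lambda>t. n (Suc j + t)) [0..<i]" by simp
    then have "w \<in> ?F i" unfolding mem_factors_of_length_iff by blast
    then show "w \<in> ?F i - {p}" using u(3) by blast
  qed
  also have "card (?F i - {p}) = card (?F i) - 1"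
    using p by simp
  finally have "card (?F (Suc i)) = 3 + (card (?F i) - 1)" .
  \<comment> \<open>Positivity makes the truncated subtraction of 1 exact.\<close>
  moreover have "card (?F i) > 0" using p fin[of i] card_gt_0_iff by blast
  ultimately show ?thesis by simp
qed

lemma card_factors_of_length: "card (factors_of_length n i) = 2 * i + 1"
proof (induction i)
  case 0
  have "factors_of_length n 0 = {[]}" by (auto simp: mem_factors_of_length_iff)
  then show ?case by simp
qed (simp add: card_factors_of_length_Suc)

end

theorem theorem13:
  fixes n :: "letter word" and i :: nat
  assumes "morph_omega narayana n = n" and "n 0 = L0"
  shows "card (factors_of_length n i) = 2 * i + 1"
proof -
  interpret narayana_word n by unfold_locales (fact assms)+
  show ?thesis by (rule card_factors_of_length)
qed

end
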